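(* Let $k\ge1$ and let $f_1,f_2,\ldots,f_k$ be non-constant entire functions such that, for some $j\in\{1,2,\ldots,k\}$, $f_j$ is a log-regular transcendental entire function. Let $g=f_1\circ f_2\circ\cdots\circ f_k$. Then $g$ is log-regular.
   Context: For an entire function $f$ put $M(r,f)=\max_{|z|=r}|f(z)|$ for $r>0$. A transcendental entire function $f$ is log-regular (with constant $c>0$) if $\phi(t)=\log M(e^t,f)$ satisfies $\phi'(t)/\phi(t)\ge (1+c)/t$ for all large $t$; it is log-regular if this holds for some $c>0$. (Since $\phi$ is convex, $\phi'$ exists outside a countable set; at exceptional points $\phi'$ is read as the right derivative.) *)

theory Defs
  imports "HOL-Complex_Analysis.Complex_Analysis"
begin

(* For r > 0 and f continuous the supremum is attained, so it is the maximum over the circle. *)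
definition max_modulus :: "real \<Rightarrow> (complex \<Rightarrow> complex) \<Rightarrow> real" where
  "max_modulus r f = (SUP z\<in>sphere 0 r. norm (f z))"

definition transcendental_entire :: "(complex \<Rightarrow> complex) \<Rightarrow> bool" where
  "transcendental_entire f \<longleftrightarrow> f holomorphic_on UNIV \<and> (\<nexists>p. f = poly p)"

definition log_max_modulus :: "(complex \<Rightarrow> complex) \<Rightarrow> real \<Rightarrow> real" where
  "log_max_modulus f t = ln (max_modulus (exp t) f)"

(* D is the right derivative of log_max_modulus f at t; it coincides with the ordinary derivative
   wherever the latter exists, and by convexity it exists at every t when f is not identically 0. *)
definition log_regular_with :: "real \<Rightarrow> (complex \<Rightarrow> complex) \<Rightarrow> bool" where
  "log_regular_with c f \<longleftrightarrow> transcendental_entire f \<and> c > 0 \<and>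
     (\<forall>\<^sub>F t in at_top. \<exists>D. (log_max_modulus f has_real_derivative D) (at_right t) \<and>
        D / log_max_modulus f t \<ge> (1 + c) / t)"

definition log_regular :: "(complex \<Rightarrow> complex) \<Rightarrow> bool" where
  "log_regular f \<longleftrightarrow> (\<exists>c. log_regular_with c f)"

end

theory Submission imports Defs "HOL-Real_Asymp.Real_Asymp"
begin

text \<open>
  Write \<open>\<phi>\<^sub>f t = log M(e\<^sup>t, f)\<close>, a convex increasing function tending to infinity. By convexity,
  log-regularity of \<open>f\<close> with constant \<open>c\<close> gives \<open>\<phi>\<^sub>f (l t) \<ge> (l + c (l - 1)) \<phi>\<^sub>f t\<close> for all \<open>l \<ge> 1\<close>
  and large \<open>t\<close>; conversely, \<open>\<phi>\<^sub>f (k t) \<ge> m \<phi>\<^sub>f t\<close> for large \<open>t\<close> and some \<open>m > k > 1\<close> bounds the right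
  derivative at \<open>k t\<close> below by the slope of the chord from \<open>t\<close>, which yields log-regularity. For a
  composition one has \<open>\<phi>\<^sub>f (\<phi>\<^sub>h (t - ln 2) - C) \<le> \<phi>\<^sub>f\<^sub>h t \<le> \<phi>\<^sub>f (\<phi>\<^sub>h t)\<close> for large \<open>t\<close>, the left inequality
  by Schottky's theorem. The loss of \<open>ln 2\<close> and \<open>C\<close> is absorbed on passing from \<open>t\<close> to \<open>2 t\<close>, since one
  of \<open>\<phi>\<^sub>f\<close>, \<open>\<phi>\<^sub>h\<close> gains a factor strictly larger than 2 and the other, being convex, almost a
  proportional factor.
\<close>

section \<open>The maximum modulus and its logarithm\<close>

lemma max_modulus_attained:
  assumes "f holomorphic_on UNIV" "r \<ge> 0"
  obtains z where "norm z = r" "norm (f z) = max_modulus r f"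
    "\<And>w. norm w = r \<Longrightarrow> norm (f w) \<le> max_modulus r f"
proof -
  have cont: "continuous_on (sphere 0 r) (\<lambda>z. norm (f z))"
    using assms holomorphic_on_imp_continuous_on continuous_on_subset
    by (intro continuous_on_norm) blast
  moreover have "complex_of_real r \<in> sphere 0 r"
    using assms by simp
  ultimately have "\<exists>z\<in>sphere 0 r. \<forall>w\<in>sphere 0 r. norm (f w) \<le> norm (f z)"
    by (intro continuous_attains_sup) auto
  then obtain z where z: "z \<in> sphere 0 r" "\<forall>w\<in>sphere 0 r. norm (f w) \<le> norm (f z)"
    by blast
  then have "max_modulus r f = norm (f z)"
    unfolding max_modulus_def by (intro cSup_eq_maximum) auto
  with z show ?thesis
    by (intro that[of z]) auto
qed

lemma norm_le_max_modulus:
  assumes f: "f holomorphic_on UNIV" and z: "norm z \<le> r"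
  shows "norm (f z) \<le> max_modulus r f"
proof (rule maximum_modulus_frontier[of f "cball 0 r"])
  have r: "r \<ge> 0"
    using z norm_ge_zero[of z] by linarith
  show "norm (f w) \<le> max_modulus r f" if "w \<in> frontier (cball 0 r)" for w
    using that max_modulus_attained[OF f r] by auto
qed (use assms in \<open>auto intro: holomorphic_on_subset holomorphic_on_imp_continuous_on\<close>)

lemma max_modulus_mono:
  assumes "f holomorphic_on UNIV" "0 \<le> r" "r \<le> s"
  shows "max_modulus r f \<le> max_modulus s f"
  by (metis assms max_modulus_attained norm_le_max_modulus)

lemma max_modulus_pos:
  assumes f: "f holomorphic_on UNIV" "\<not> f constant_on UNIV" and r: "r > 0"
  shows "max_modulus r f > 0"
proof (rule ccontr)
  assume "\<not> max_modulus r f > 0"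
  then have nonpos: "max_modulus r f \<le> 0" by simp
  have zero: "f z = 0" if "z \<in> ball 0 r" for z
    using order_trans[OF norm_le_max_modulus[OF f(1), of z r] nonpos] that by simp
  have "f z = 0" for z
    by (rule analytic_continuation[of f UNIV "ball 0 r" 0])
       (use f r zero in \<open>auto simp: islimpt_ball\<close>)
  then show False
    using f(2) by (auto simp: constant_on_def)
qed

text \<open>Non-constancy makes the maximum modulus positive, so \<open>ln\<close> is never applied
  at 0. Inequalities later pass between \<open>max_modulus\<close> and
  \<open>log_max_modulus\<close> through this identity.\<close>

lemma exp_log_max_modulus:
  assumes "f holomorphic_on UNIV" "\<not> f constant_on UNIV"
  shows "exp (log_max_modulus f t) = max_modulus (exp t) f"
  by (simp add: log_max_modulus_def max_modulus_pos[OF assms])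

lemma mono_log_max_modulus:
  assumes "f holomorphic_on UNIV" "\<not> f constant_on UNIV"
  shows "mono (log_max_modulus f)"
  by (intro monoI, subst exp_le_cancel_iff[symmetric])
     (simp add: exp_log_max_modulus[OF assms] max_modulus_mono assms)

text \<open>By Liouville's theorem the modulus exceeds any bound somewhere, and the maximum
  principle carries that value to all larger circles.\<close>

lemma log_max_modulus_at_top:
  assumes f: "f holomorphic_on UNIV" "\<not> f constant_on UNIV"
  shows "filterlim (log_max_modulus f) at_top at_top"
  unfolding filterlim_at_top
proof
  fix B
  have "\<not> bounded (range f)"
    using Liouville_theorem f by blast
  then obtain z where z: "norm (f z) > exp B"
    by (metis boundedI imageE not_less)
  show "\<forall>\<^sub>F t in at_top. B \<le> log_max_modulus f t"
    using eventually_ge_at_top[of "ln (norm z + 1)"]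
  proof eventually_elim
    case (elim t)
    then have "norm z \<le> exp t"
      by (smt (verit) exp_ln exp_le_cancel_iff norm_ge_zero)
    then have "exp B \<le> exp (log_max_modulus f t)"
      using z norm_le_max_modulus[OF f(1), of z "exp t"] by (simp add: exp_log_max_modulus f)
    then show ?case by simp
  qed
qed

text \<open>Hadamard's three circles theorem. With \<open>a\<close> the slope of the chord, \<open>f (exp w) * exp (- a * w)\<close>
  is entire and its modulus has period \<open>2 * pi * \<i>\<close>, so it attains its maximum on a closed vertical strip.\<close>
lemma convex_log_max_modulus:
  assumes f: "f holomorphic_on UNIV" "\<not> f constant_on UNIV"
  shows "convex_on UNIV (log_max_modulus f)"
proof (rule convex_on_linorderI)
  fix t x y :: real
  assume t: "0 < t" "t < 1" and xy: "x < y"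
  define \<phi> where "\<phi> = log_max_modulus f"
  define a where "a = (\<phi> y - \<phi> x) / (y - x)"
  define u where "u = (1 - t) * x + t * y"
  define h where "h w = f (exp w) * exp (- of_real a * w)" for w
  have a: "a * (y - x) = \<phi> y - \<phi> x"
    using xy by (simp add: a_def)
  have u: "u - x = t * (y - x)" "y - u = (1 - t) * (y - x)"
    by (simp_all add: u_def algebra_simps)
  have "u - x > 0" "y - u > 0"
    unfolding u using t xy by simp_all
  then have u': "x < u" "u < y"
    by simp_all
  have norm_h: "norm (h w) = norm (f (exp w)) * exp (- a * Re w)" for w
    by (simp add: h_def norm_mult)
  have h_le: "norm (h w) \<le> exp (\<phi> (Re w) - a * Re w)" for w
  proof -
    have "norm (f (exp w)) \<le> exp (\<phi> (Re w))"
      using norm_le_max_modulus[OF f(1), of "exp w" "exp (Re w)"]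
      by (simp add: \<phi>_def exp_log_max_modulus f)
    then show ?thesis
      by (simp add: norm_h exp_diff exp_minus divide_inverse)
  qed
  have h_hol: "h holomorphic_on UNIV"
    unfolding h_def using holomorphic_on_compose_gen[OF holomorphic_on_exp f(1)]
    by (intro holomorphic_intros) (auto simp: o_def)
  define K where "K = cbox (Complex x (- pi)) (Complex y pi)"
  have "Complex x 0 \<in> K"
    using xy by (simp add: K_def in_cbox_complex_iff)
  then obtain w0 where w0: "w0 \<in> K" "\<And>w. w \<in> K \<Longrightarrow> norm (h w) \<le> norm (h w0)"
    using continuous_attains_sup[of K "\<lambda>w. norm (h w)"] h_hol
    by (metis K_def compact_cbox continuous_on_norm continuous_on_subset empty_iff
        holomorphic_on_imp_continuous_on subset_UNIV)
  have strip: "norm (h w) \<le> norm (h w0)" if "x \<le> Re w" "Re w \<le> y" for w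
  proof -
    have "norm (h w) = norm (h (Ln (exp w)))"
      by (simp add: norm_h)
    also have "Ln (exp w) \<in> K"
      using that mpi_less_Im_Ln[of "exp w"] Im_Ln_le_pi[of "exp w"]
      by (simp add: K_def in_cbox_complex_iff less_imp_le)
    then have "norm (h (Ln (exp w))) \<le> norm (h w0)"
      by (rule w0)
    finally show ?thesis .
  qed
  have "\<phi> u \<le> \<phi> x + a * (u - x)"
  proof (rule ccontr)
    assume neg: "\<not> \<phi> u \<le> \<phi> x + a * (u - x)"
    obtain z where z: "norm z = exp u" "norm (f z) = exp (\<phi> u)"
      using max_modulus_attained[OF f(1), of "exp u"]
      by (auto simp: \<phi>_def exp_log_max_modulus f)
    then have "z \<noteq> 0" by auto
    then have "norm (h (Ln z)) = exp (\<phi> u - a * u)" "Re (Ln z) = u"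
      using z by (simp_all add: norm_h exp_diff exp_minus divide_inverse)
    then have "exp (\<phi> u - a * u) \<le> norm (h w0)"
      using strip[of "Ln z"] u' by simp
    moreover have "exp (\<phi> x - a * x) < exp (\<phi> u - a * u)"
      using neg by (simp add: algebra_simps)
    ultimately have big: "exp (\<phi> x - a * x) < norm (h w0)"
      by linarith
    have "\<phi> y - a * y = \<phi> x - a * x"
      using a by (simp add: algebra_simps)
    then have "Re w0 \<noteq> x" "Re w0 \<noteq> y"
      using big h_le[of w0] by auto
    then have w0': "x < Re w0" "Re w0 < y"
      using w0(1) by (auto simp: K_def in_cbox_complex_iff)
    have "h constant_on UNIV"
    proof (rule maximum_modulus_principle[where U = "{w. x < Re w} \<inter> {w. Re w < y}" and \<xi> = w0])
      show "open ({w. x < Re w} \<inter> {w. Re w < y})"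
        by (intro open_Int open_halfspace_Re_gt open_halfspace_Re_lt)
    qed (use h_hol w0' strip in auto)
    then have "h (of_real x) = h w0"
      by (auto simp: constant_on_def)
    then show False
      using h_le[of "of_real x"] big by simp
  qed
  also have "\<phi> x + a * (u - x) = \<phi> x + t * (a * (y - x))"
    by (simp add: u)
  also have "\<dots> = (1 - t) * \<phi> x + t * \<phi> y"
    by (simp only: a) (simp add: algebra_simps)
  finally show "log_max_modulus f ((1 - t) *\<^sub>R x + t *\<^sub>R y)
      \<le> (1 - t) * log_max_modulus f x + t * log_max_modulus f y"
    by (simp add: \<phi>_def u_def)
qed simp

section \<open>Secants and right derivatives of convex functions\<close>

lemma convex_secant_le:
  fixes \<phi> :: "real \<Rightarrow> real"
  assumes "convex_on UNIV \<phi>" "x < y" "y < z"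
  shows "(\<phi> y - \<phi> x) / (y - x) \<le> (\<phi> z - \<phi> x) / (z - x)"
    and "(\<phi> z - \<phi> x) / (z - x) \<le> (\<phi> z - \<phi> y) / (z - y)"
  using convex_on_slope_le[OF assms(1), of x z y] assms(2,3)
  by (simp_all add: field_simps)

text \<open>Secant slopes from \<open>t\<close> to points on its right decrease as these approach
  \<open>t\<close> and stay above every secant slope from the left. They converge to their infimum,
  which inherits this lower bound.\<close>

lemma convex_right_derivative:
  fixes \<phi> :: "real \<Rightarrow> real"
  assumes \<phi>: "convex_on UNIV \<phi>"
  obtains D where "(\<phi> has_real_derivative D) (at_right t)"
    "\<And>s. s < t \<Longrightarrow> (\<phi> t - \<phi> s) / (t - s) \<le> D"
proof -
  define q where "q s = (\<phi> s - \<phi> t) / (s - t)" for s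
  define D where "D = Inf (q ` {t<..})"
  have low: "(\<phi> t - \<phi> s) / (t - s) \<le> q u" if "s < t" "t < u" for s u
    using convex_secant_le[OF \<phi> that] unfolding q_def by linarith
  have bdd: "bdd_below (q ` {t<..})"
    using low[of "t - 1"] by (intro bdd_belowI2[where m = "(\<phi> t - \<phi> (t - 1)) / (t - (t - 1))"]) simp
  have "(q \<longlongrightarrow> D) (at_right t)"
  proof (rule order_tendstoI)
    fix b assume "b < D"
    then have "b < q s" if "s > t" for s
      using cInf_lower[OF _ bdd, of "q s"] that unfolding D_def by fastforce
    then show "\<forall>\<^sub>F s in at_right t. b < q s"
      by (auto simp: eventually_at_right_field intro!: exI[of _ "t + 1"])
  next
    fix b assume "D < b"
    then obtain s where s: "s > t" "q s < b"
      unfolding D_def using cInf_less_iff[OF _ bdd, of b] by auto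
    then have "q u < b" if "t < u" "u < s" for u
      using convex_secant_le(1)[OF \<phi> that] unfolding q_def by linarith
    then show "\<forall>\<^sub>F u in at_right t. q u < b"
      using s by (auto simp: eventually_at_right_field)
  qed
  then have "(\<phi> has_real_derivative D) (at_right t)"
    by (simp add: has_field_derivative_iff q_def[abs_def])
  moreover have "(\<phi> t - \<phi> s) / (t - s) \<le> D" if "s < t" for s
    unfolding D_def using low[OF that] by (intro cInf_greatest) auto
  ultimately show ?thesis
    using that by blast
qed

text \<open>The secant slope from \<open>t\<close> to \<open>u\<close> is at most the one to
  \<open>s\<close> for \<open>t < u < s\<close>; let \<open>u\<close> tend to
  \<open>t\<close>.\<close>

lemma convex_above_right_tangent:
  fixes \<phi> :: "real \<Rightarrow> real"
  assumes \<phi>: "convex_on UNIV \<phi>" and D: "(\<phi> has_real_derivative D) (at_right t)" and "t \<le> s"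
  shows "\<phi> t + D * (s - t) \<le> \<phi> s"
proof (cases "t = s")
  case False
  with \<open>t \<le> s\<close> have "t < s" by simp
  have lim: "((\<lambda>u. (\<phi> u - \<phi> t) / (u - t)) \<longlongrightarrow> D) (at_right t)"
    using D by (simp add: has_field_derivative_iff)
  have "\<forall>\<^sub>F u in at_right t. (\<phi> u - \<phi> t) / (u - t) \<le> (\<phi> s - \<phi> t) / (s - t)"
    using \<open>t < s\<close> convex_secant_le(1)[OF \<phi>] by (auto simp: eventually_at_right_field)
  then have "D \<le> (\<phi> s - \<phi> t) / (s - t)"
    by (rule tendsto_upperbound[OF lim]) simp
  then show ?thesis
    using \<open>t < s\<close> by (simp add: field_simps)
qed simp

text \<open>Comparing the secants from 0 to \<open>t\<close> and to \<open>m * t\<close> gives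
  \<open>m * \<phi> t - (m - 1) * \<phi> 0 \<le> \<phi> (m * t)\<close>. The surplus
  \<open>(m - l) * \<phi> t\<close> tends to infinity and pays for the constants.\<close>

lemma convex_dilation_lower_bound:
  fixes \<phi> :: "real \<Rightarrow> real"
  assumes \<phi>: "convex_on UNIV \<phi>" "filterlim \<phi> at_top at_top" and "1 < m" "l < m"
  shows "\<forall>\<^sub>F t in at_top. l * \<phi> t + C \<le> \<phi> (m * t)"
proof -
  have "\<forall>\<^sub>F t in at_top. ((m - 1) * \<phi> 0 + C) / (m - l) \<le> \<phi> t"
    using \<phi>(2) by (auto simp: filterlim_at_top)
  with eventually_gt_at_top[of 0] show ?thesis
  proof eventually_elim
    case (elim t)
    have "t < m * t"
      using elim \<open>1 < m\<close> by simp
    with elim have "(\<phi> t - \<phi> 0) / t \<le> (\<phi> (m * t) - \<phi> 0) / (m * t)"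
      using convex_secant_le(1)[OF \<phi>(1), of 0 t "m * t"] by simp
    then have "m * (\<phi> t - \<phi> 0) \<le> \<phi> (m * t) - \<phi> 0"
      using elim \<open>1 < m\<close> by (simp add: pos_le_divide_eq mult.commute)
    moreover have "(m - 1) * \<phi> 0 + C \<le> (m - l) * \<phi> t"
      using elim \<open>l < m\<close> by (simp add: field_simps)
    ultimately show ?case
      by (simp add: algebra_simps)
  qed
qed

section \<open>Superlinear growth and log-regularity\<close>

lemma max_modulus_poly_le:
  obtains n C where "\<And>t. t \<ge> 0 \<Longrightarrow> max_modulus (exp t) (poly p) \<le> exp (C + n * t)"
proof -
  \<comment> \<open>The summand 1 keeps \<open>B\<close> positive even for the zero polynomial, so
    that \<open>exp (ln B) = B\<close>.\<close>
  define B where "B = 1 + (\<Sum>i\<le>degree p. norm (coeff p i))"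
  have B: "B > 0"
    unfolding B_def by (intro add_pos_nonneg sum_nonneg) auto
  have "max_modulus (exp t) (poly p) \<le> exp (ln B + real (degree p) * t)" if "t \<ge> 0" for t
  proof -
    obtain z where z: "norm z = exp t" "norm (poly p z) = max_modulus (exp t) (poly p)"
      using max_modulus_attained[of "poly p" "exp t"]
      by (metis exp_ge_zero field_differentiable_at_within field_differentiable_def holomorphic_on_def poly_DERIV)
    have "norm (poly p z) \<le> (\<Sum>i\<le>degree p. norm (coeff p i * z ^ i))"
      unfolding poly_altdef by (rule norm_sum)
    also have "\<dots> \<le> (\<Sum>i\<le>degree p. norm (coeff p i) * exp t ^ degree p)"
      using that by (intro sum_mono) (auto simp: norm_mult norm_power z intro!: mult_left_mono power_increasing)
    also have "\<dots> \<le> B * exp t ^ degree p"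
      unfolding B_def by (simp add: sum_distrib_right[symmetric] distrib_right)
    also have "\<dots> = exp (ln B + real (degree p) * t)"
      using B by (simp add: exp_add exp_of_nat_mult)
    finally show ?thesis
      using z by simp
  qed
  then show ?thesis
    by (rule that)
qed

text \<open>Iterating the hypothesis gives a factor of at least \<open>m ^ j\<close> at
  \<open>k ^ j * t\<close>. Since \<open>k < m\<close>, this outgrows the bound linear in
  \<open>t\<close> that holds for a polynomial.\<close>

lemma transcendental_if_superlinear:
  assumes f: "f holomorphic_on UNIV" "\<not> f constant_on UNIV"
    and k: "1 < k" "k < m"
    and ev: "\<forall>\<^sub>F t in at_top. m * log_max_modulus f t \<le> log_max_modulus f (k * t)"
  shows "transcendental_entire f"
  unfolding transcendental_entire_def
proof (intro conjI notI)
  assume "\<exists>p. f = poly p"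
  then obtain p where p: "f = poly p" by blast
  obtain n C where "\<And>t. t \<ge> 0 \<Longrightarrow> max_modulus (exp t) (poly p) \<le> exp (C + n * t)"
    using max_modulus_poly_le by blast
  then have le: "log_max_modulus f t \<le> C + n * t" if "t \<ge> 0" for t
    using that p exp_log_max_modulus[OF f, of t] by (metis exp_le_cancel_iff)
  have "\<forall>\<^sub>F t in at_top. 0 < log_max_modulus f t"
    using log_max_modulus_at_top[OF f] by (simp add: filterlim_at_top_dense)
  from eventually_conj[OF ev this] obtain T where
    T: "\<And>t. t \<ge> T \<Longrightarrow> m * log_max_modulus f t \<le> log_max_modulus f (k * t) \<and> 0 < log_max_modulus f t"
    by (auto simp: eventually_at_top_linorder)
  define t where "t = max T 1"
  have t: "t \<ge> 1" "t \<ge> T"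
    by (auto simp: t_def)
  have kj: "k ^ j \<ge> 1" for j
    using k by simp
  have grow: "m ^ j * log_max_modulus f t \<le> log_max_modulus f (k ^ j * t)" for j
  proof (induction j)
    case (Suc j)
    have "1 * t \<le> k ^ j * t"
      using t kj by (intro mult_right_mono) auto
    then have "m * log_max_modulus f (k ^ j * t) \<le> log_max_modulus f (k * (k ^ j * t))"
      using T[of "k ^ j * t"] t by linarith
    moreover have "m * (m ^ j * log_max_modulus f t) \<le> m * log_max_modulus f (k ^ j * t)"
      using Suc k by (intro mult_left_mono) auto
    ultimately show ?case
      by (simp add: mult.assoc)
  qed simp
  have bd: "(m / k) ^ j * log_max_modulus f t \<le> \<bar>C\<bar> + n * t" for j
  proof -
    have "m ^ j * log_max_modulus f t \<le> C + n * (k ^ j * t)"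
      using grow[of j] le[of "k ^ j * t"] kj[of j] t by simp
    also have "\<dots> \<le> \<bar>C\<bar> * k ^ j + n * (k ^ j * t)"
      using mult_left_mono[OF kj[of j], of "\<bar>C\<bar>"] by simp
    finally show ?thesis
      using kj[of j] k by (simp add: field_simps power_divide)
  qed
  obtain j where "(\<bar>C\<bar> + n * t) / log_max_modulus f t < (m / k) ^ j"
    using real_arch_pow[of "m / k"] k by auto
  then show False
    using bd[of j] T[of t] t by (simp add: field_simps)
qed (rule f)

lemma log_regular_if_superlinear:
  assumes f: "f holomorphic_on UNIV" "\<not> f constant_on UNIV"
    and k: "1 < k" "k < m"
    and ev: "\<forall>\<^sub>F t in at_top. m * log_max_modulus f t \<le> log_max_modulus f (k * t)"
  shows "log_regular f"
proof -
  define \<phi> where "\<phi> = log_max_modulus f"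
  \<comment> \<open>Solves \<open>(1 + c) * (1 - 1 / k) = 1 - 1 / m\<close>: from
    \<open>t / k\<close> to \<open>t\<close> the function gains at least
    \<open>(1 - 1 / m) * \<phi> t\<close> over a length \<open>(1 - 1 / k) * t\<close>, so the chord
    has slope at least \<open>(1 + c) * \<phi> t / t\<close>.\<close>
  define c where "c = (1 - k / m) / (k - 1)"
  have c: "c > 0"
    using k by (simp add: c_def)
  have c1: "(1 + c) * (1 - 1 / k) = 1 - 1 / m"
    using k by (simp add: c_def field_simps)
  have "\<forall>\<^sub>F t in at_top. m * \<phi> (t / k) \<le> \<phi> t"
  proof -
    obtain T where T: "\<And>t. t \<ge> T \<Longrightarrow> m * \<phi> t \<le> \<phi> (k * t)"
      using ev by (auto simp: eventually_at_top_linorder \<phi>_def)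
    show ?thesis
      using eventually_ge_at_top[of "k * T"]
    proof eventually_elim
      case (elim t)
      then have "T \<le> t / k"
        using k by (simp add: field_simps)
      from T[OF this] show ?case
        using k by simp
    qed
  qed
  moreover have "\<forall>\<^sub>F t in at_top. 0 < \<phi> t"
    using log_max_modulus_at_top[OF f] by (simp add: filterlim_at_top_dense \<phi>_def)
  ultimately have "\<forall>\<^sub>F t in at_top. \<exists>D. (\<phi> has_real_derivative D) (at_right t) \<and> (1 + c) / t \<le> D / \<phi> t"
    using eventually_gt_at_top[of 0]
  proof eventually_elim
    case (elim t)
    obtain D where D: "(\<phi> has_real_derivative D) (at_right t)"
        "\<And>s. s < t \<Longrightarrow> (\<phi> t - \<phi> s) / (t - s) \<le> D"
      using convex_right_derivative[of \<phi> t] convex_log_max_modulus[OF f] unfolding \<phi>_def by blast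
    have pos: "0 < t * (1 - 1 / k)"
      using elim k by simp
    have "\<phi> t * ((1 + c) * (1 - 1 / k)) \<le> \<phi> t - \<phi> (t / k)"
      unfolding c1 using elim k by (simp add: field_simps)
    also have "\<dots> \<le> D * (t * (1 - 1 / k))"
    proof -
      have "t / k < t"
        using elim k by (simp add: field_simps)
      moreover from this have "(\<phi> t - \<phi> (t / k)) / (t - t / k) \<le> D"
        by (rule D)
      ultimately show ?thesis
        by (simp add: pos_divide_le_eq right_diff_distrib)
    qed
    finally have "(\<phi> t * (1 + c)) * (1 - 1 / k) \<le> (D * t) * (1 - 1 / k)"
      by (simp only: mult.assoc)
    then have "\<phi> t * (1 + c) \<le> D * t"
      by (rule mult_right_le_imp_le) (use k in simp)
    then have "(1 + c) / t \<le> D / \<phi> t"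
      using elim by (simp add: field_simps)
    with D show ?case by blast
  qed
  then show ?thesis
    unfolding log_regular_def log_regular_with_def
    using transcendental_if_superlinear[OF assms] c by (auto simp: \<phi>_def)
qed

lemma transcendental_entire_not_constant:
  assumes "transcendental_entire f"
  shows "\<not> f constant_on UNIV"
proof
  assume "f constant_on UNIV"
  then obtain c where "\<And>z. f z = c"
    by (auto simp: constant_on_def)
  then have "f = poly [:c:]"
    by auto
  then show False
    using assms unfolding transcendental_entire_def by blast
qed

text \<open>The right tangent at \<open>t\<close> stays below the graph, and its slope is at least
  \<open>(1 + c) / t\<close> times the value at \<open>t\<close>. One tangent serves every
  \<open>l\<close>, so the threshold for \<open>t\<close> does not depend on
  \<open>l\<close>.\<close>

lemma log_regular_superlinear:
  assumes "log_regular f"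
  obtains c where "c > 0"
    "\<forall>\<^sub>F t in at_top. \<forall>l\<ge>1. (l + c * (l - 1)) * log_max_modulus f t \<le> log_max_modulus f (l * t)"
proof -
  obtain c where c: "transcendental_entire f" "c > 0"
    and ev: "\<forall>\<^sub>F t in at_top. \<exists>D. (log_max_modulus f has_real_derivative D) (at_right t) \<and>
        D / log_max_modulus f t \<ge> (1 + c) / t"
    using assms by (auto simp: log_regular_def log_regular_with_def)
  have f: "f holomorphic_on UNIV" "\<not> f constant_on UNIV"
    using c(1) transcendental_entire_not_constant by (auto simp: transcendental_entire_def)
  have "\<forall>\<^sub>F t in at_top. 0 < log_max_modulus f t"
    using log_max_modulus_at_top[OF f] by (simp add: filterlim_at_top_dense)
  with ev eventually_gt_at_top[of 0]
  have "\<forall>\<^sub>F t in at_top. \<forall>l\<ge>1. (l + c * (l - 1)) * log_max_modulus f t \<le> log_max_modulus f (l * t)"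
  proof eventually_elim
    case (elim t)
    then obtain D where D: "(log_max_modulus f has_real_derivative D) (at_right t)"
      "(1 + c) / t \<le> D / log_max_modulus f t" by blast
    show ?case
    proof (intro allI impI)
      fix l :: real assume l: "l \<ge> 1"
      have "(1 + c) * log_max_modulus f t \<le> D * t"
        using D(2) elim by (simp add: field_simps)
      then have "(l - 1) * ((1 + c) * log_max_modulus f t) \<le> (l - 1) * (D * t)"
        using l by (intro mult_left_mono) auto
      moreover have "log_max_modulus f t + D * (l * t - t) \<le> log_max_modulus f (l * t)"
        using elim l
        by (intro convex_above_right_tangent[OF convex_log_max_modulus[OF f] D(1)]) simp
      ultimately show "(l + c * (l - 1)) * log_max_modulus f t \<le> log_max_modulus f (l * t)"
        by (simp add: algebra_simps)
    qed
  qed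
  with c(2) show ?thesis
    by (rule that)
qed

section \<open>Growth of compositions via Schottky's theorem\<close>

text \<open>Three times the bound of Schottky's theorem on the disc of radius 1/2 for functions of modulus at
  most 2 at 0, plus 1.\<close>
definition omission_bound :: real where
  "omission_bound = 1 + 3 * exp (pi * exp (pi * (2 + 2 * 2 + 12 * (1 / 2) / (1 - 1 / 2))))"

lemma omission_bound_pos: "omission_bound > 0"
  by (simp add: omission_bound_def add_pos_pos)

text \<open>Rescale the disc to radius 1 and move \<open>w1\<close>, \<open>w2\<close> to 0, 1 by an
  affine map. As \<open>w2\<close> has twice the modulus of \<open>w1\<close>, their distance is
  between 1 and 3 times \<open>norm w1\<close>: the lower bound gives
  \<open>norm (F 0) \<le> 2\<close>, the upper one the factor 3 on scaling back.\<close>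

lemma Schottky_two_omitted_values:
  assumes h: "h holomorphic_on UNIV" and r: "r > 0"
    and w: "norm (h 0) \<le> norm w1" "norm w2 = 2 * norm w1" "w1 \<noteq> 0"
    and omit: "\<And>z. norm z \<le> r \<Longrightarrow> h z \<noteq> w1 \<and> h z \<noteq> w2" and z: "norm z \<le> r / 2"
  shows "norm (h z) \<le> omission_bound * norm w1"
proof -
  define F where "F \<zeta> = (h (of_real r * \<zeta>) - w1) / (w2 - w1)" for \<zeta>
  define S where "S = exp (pi * exp (pi * (2 + 2 * 2 + 12 * (1 / 2) / (1 - 1 / 2))))"
  have d: "norm w1 \<le> norm (w2 - w1)" "norm (w2 - w1) \<le> 3 * norm w1"
    using norm_triangle_ineq2[of w2 w1] norm_triangle_ineq4[of w2 w1] w by auto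
  have d0: "w2 - w1 \<noteq> 0"
    using d w by auto
  have F_le: "norm (F (z / of_real r)) \<le> S"
    unfolding S_def
  proof (rule Schottky[where f = F])
    have "(\<lambda>\<zeta>. h (of_real r * \<zeta>)) holomorphic_on cball 0 1"
      using holomorphic_on_compose_gen[of "\<lambda>\<zeta>. of_real r * \<zeta>" "cball 0 1" h UNIV] h
      by (auto simp: o_def intro: holomorphic_intros)
    then show "F holomorphic_on cball 0 1"
      unfolding F_def using d0 by (intro holomorphic_intros) auto
    have "norm (h 0 - w1) \<le> 2 * norm w1"
      using norm_triangle_ineq4[of "h 0" w1] w by linarith
    then show "norm (F 0) \<le> 2"
      using d d0 by (simp add: F_def norm_divide divide_le_eq)
    show "\<not> (F \<zeta> = 0 \<or> F \<zeta> = 1)" if "\<zeta> \<in> cball 0 1" for \<zeta>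
      using omit[of "of_real r * \<zeta>"] that r d0 by (auto simp: F_def norm_mult)
    show "norm (z / of_real r) \<le> 1 / 2"
      using z r by (simp add: norm_divide field_simps)
  qed auto
  have "h z - w1 = F (z / of_real r) * (w2 - w1)"
    using d0 r by (simp add: F_def)
  then have "norm (h z - w1) \<le> S * (3 * norm w1)"
    using F_le d(2) by (auto simp: norm_mult S_def intro!: mult_mono)
  moreover have "omission_bound = 1 + 3 * S"
    by (simp only: omission_bound_def S_def)
  ultimately have "norm (h z) \<le> norm w1 + S * (3 * norm w1)"
    using norm_triangle_sub[of "h z" w1] by linarith
  also have "\<dots> = omission_bound * norm w1"
    unfolding \<open>omission_bound = 1 + 3 * S\<close> by (simp add: algebra_simps)
  finally show ?thesis .
qed

text \<open>The points \<open>w1\<close>, \<open>w2\<close> at which \<open>f\<close> attains its maximum on the circles of radii \<open>\<rho>\<close> and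
  \<open>2 * \<rho>\<close> cannot both be omitted by \<open>h\<close> on the disc of radius \<open>r\<close>.\<close>
lemma max_modulus_compose_ge:
  assumes f: "f holomorphic_on UNIV" and h: "h holomorphic_on UNIV" and r: "r > 0" and \<rho>: "\<rho> > 0"
    and h0: "norm (h 0) \<le> \<rho>" and big: "omission_bound * \<rho> < max_modulus (r / 2) h"
  shows "max_modulus \<rho> f \<le> max_modulus r (f \<circ> h)"
proof -
  obtain w1 where w1: "norm w1 = \<rho>" "norm (f w1) = max_modulus \<rho> f"
    using max_modulus_attained[OF f, of \<rho>] \<rho> by auto
  obtain w2 where w2: "norm w2 = 2 * \<rho>" "norm (f w2) = max_modulus (2 * \<rho>) f"
    using max_modulus_attained[OF f, of "2 * \<rho>"] \<rho> by auto
  obtain z0 where z0: "norm z0 = r / 2" "norm (h z0) = max_modulus (r / 2) h"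
    using max_modulus_attained[OF h, of "r / 2"] r by auto
  obtain z where z: "norm z \<le> r" "h z = w1 \<or> h z = w2"
  proof (rule ccontr)
    assume "\<not> thesis"
    then have omit: "h z \<noteq> w1 \<and> h z \<noteq> w2" if "norm z \<le> r" for z
      using that \<open>\<And>z. norm z \<le> r \<Longrightarrow> h z = w1 \<or> h z = w2 \<Longrightarrow> thesis\<close> by blast
    have "norm (h z0) \<le> omission_bound * norm w1"
    proof (rule Schottky_two_omitted_values[OF h r])
      show "w1 \<noteq> 0" using w1 \<rho> by auto
      show "h z \<noteq> w1 \<and> h z \<noteq> w2" if "norm z \<le> r" for z
        using omit[OF that] .
    qed (use h0 w1 w2 z0 in simp_all)
    then show False
      using big z0 w1 by simp
  qed
  \<comment> \<open>Either value suffices: at \<open>w2\<close> the modulus of \<open>f\<close> is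
    the maximum on an even larger circle.\<close>
  have "max_modulus \<rho> f \<le> max_modulus (2 * \<rho>) f"
    using \<rho> by (intro max_modulus_mono f) auto
  then have "max_modulus \<rho> f \<le> norm (f (h z))"
    using z(2) w1 w2 by (elim disjE) simp_all
  also have "\<dots> = norm ((f \<circ> h) z)"
    by simp
  also have "f \<circ> h holomorphic_on UNIV"
    using holomorphic_on_compose_gen[OF h f] by simp
  then have "norm ((f \<circ> h) z) \<le> max_modulus r (f \<circ> h)"
    using z(1) by (rule norm_le_max_modulus)
  finally show ?thesis .
qed

text \<open>The right side is not put under a logarithm because \<open>f \<circ> h\<close> is not
  yet known to be non-constant; \<open>compose_not_constant\<close> deduces that from this
  bound.\<close>

lemma log_max_modulus_compose_ge:
  assumes f: "f holomorphic_on UNIV" "\<not> f constant_on UNIV"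
    and h: "h holomorphic_on UNIV" "\<not> h constant_on UNIV"
  obtains C where
    "\<forall>\<^sub>F t in at_top. exp (log_max_modulus f (log_max_modulus h (t - ln 2) - C)) \<le> max_modulus (exp t) (f \<circ> h)"
proof -
  \<comment> \<open>The factor 2 makes the inequality required by
    \<open>max_modulus_compose_ge\<close> strict; the shift by \<open>ln 2\<close> in
    \<open>t\<close> is its halving of the radius.\<close>
  define C where "C = ln (2 * omission_bound)"
  have "filterlim (\<lambda>t. log_max_modulus h (t - ln 2)) at_top at_top"
    by (rule filterlim_compose[OF log_max_modulus_at_top[OF h]]) real_asymp
  then have "\<forall>\<^sub>F t in at_top. ln (norm (h 0) + 1) + C \<le> log_max_modulus h (t - ln 2)"
    by (auto simp: filterlim_at_top)
  then have "\<forall>\<^sub>F t in at_top. exp (log_max_modulus f (log_max_modulus h (t - ln 2) - C)) \<le> max_modulus (exp t) (f \<circ> h)"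
  proof eventually_elim
    case (elim t)
    let ?\<rho> = "exp (log_max_modulus h (t - ln 2) - C)"
    have "exp (ln (norm (h 0) + 1)) \<le> ?\<rho>"
      using elim by simp
    then have 1: "norm (h 0) \<le> ?\<rho>"
      by (simp add: add_nonneg_pos)
    have "?\<rho> = max_modulus (exp t / 2) h / (2 * omission_bound)"
      using omission_bound_pos by (simp add: exp_diff exp_log_max_modulus h C_def)
    moreover have "max_modulus (exp t / 2) h > 0"
      using max_modulus_pos[OF h] by simp
    ultimately have 2: "omission_bound * ?\<rho> < max_modulus (exp t / 2) h"
      using omission_bound_pos by simp
    show ?case
      using max_modulus_compose_ge[OF f(1) h(1) _ _ 1 2] by (simp add: exp_log_max_modulus f)
  qed
  then show ?thesis
    by (rule that)
qed

lemma max_modulus_compose_le: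
  assumes f: "f holomorphic_on UNIV" "\<not> f constant_on UNIV"
    and h: "h holomorphic_on UNIV" "\<not> h constant_on UNIV"
  shows "max_modulus (exp t) (f \<circ> h) \<le> exp (log_max_modulus f (log_max_modulus h t))"
proof -
  have "f \<circ> h holomorphic_on UNIV"
    using holomorphic_on_compose_gen[OF h(1) f(1)] by simp
  then obtain z where z: "norm z = exp t" "norm ((f \<circ> h) z) = max_modulus (exp t) (f \<circ> h)"
    using max_modulus_attained[of "f \<circ> h" "exp t"] by auto
  have "norm (h z) \<le> exp (log_max_modulus h t)"
    using norm_le_max_modulus[OF h(1), of z] z by (simp add: exp_log_max_modulus h)
  from norm_le_max_modulus[OF f(1) this] show ?thesis
    using z by (simp add: exp_log_max_modulus f)
qed

text \<open>A constant composition would have a constant maximum modulus, but the lower bound from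
  \<open>log_max_modulus_compose_ge\<close> tends to infinity.\<close>

lemma compose_not_constant:
  assumes f: "f holomorphic_on UNIV" "\<not> f constant_on UNIV"
    and h: "h holomorphic_on UNIV" "\<not> h constant_on UNIV"
  shows "\<not> (f \<circ> h) constant_on UNIV"
proof
  assume "(f \<circ> h) constant_on UNIV"
  then obtain a where a: "\<And>z. (f \<circ> h) z = a"
    by (auto simp: constant_on_def)
  obtain C where C: "\<forall>\<^sub>F t in at_top.
      exp (log_max_modulus f (log_max_modulus h (t - ln 2) - C)) \<le> max_modulus (exp t) (f \<circ> h)"
    using log_max_modulus_compose_ge[OF assms] by blast
  have "filterlim (\<lambda>t. log_max_modulus h (t - ln 2)) at_top at_top"
    by (rule filterlim_compose[OF log_max_modulus_at_top[OF h]]) real_asymp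
  then have "filterlim (\<lambda>t. log_max_modulus h (t - ln 2) - C) at_top at_top"
    by (simp add: filterlim_at_top le_diff_eq)
  then have "filterlim (\<lambda>t. log_max_modulus f (log_max_modulus h (t - ln 2) - C)) at_top at_top"
    by (rule filterlim_compose[OF log_max_modulus_at_top[OF f]])
  then have "\<forall>\<^sub>F t in at_top. norm a \<le> log_max_modulus f (log_max_modulus h (t - ln 2) - C)"
    by (auto simp: filterlim_at_top)
  with C have "\<forall>\<^sub>F t in at_top :: real filter. False"
  proof eventually_elim
    case (elim t)
    have "max_modulus (exp t) (f \<circ> h) = norm a"
      unfolding max_modulus_def a by (rule cSUP_const) simp
    then show ?case
      using elim exp_ge_add_one_self[of "log_max_modulus f (log_max_modulus h (t - ln 2) - C)"]
      by linarith
  qed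
  then show False by simp
qed

section \<open>Log-regularity of a composition of two functions\<close>

text \<open>Combines the upper bound at \<open>t\<close> with the lower bound at
  \<open>2 * t\<close> and applies \<open>log_regular_if_superlinear\<close> with
  \<open>k = 2\<close>. The hypothesis ranges over all \<open>C\<close> because the constant of the
  lower bound is only known to exist.\<close>

lemma log_regular_compose_if:
  assumes f: "f holomorphic_on UNIV" "\<not> f constant_on UNIV"
    and h: "h holomorphic_on UNIV" "\<not> h constant_on UNIV"
    and "m > 2"
    and gap: "\<And>C. \<forall>\<^sub>F t in at_top. m * log_max_modulus f (log_max_modulus h t)
      \<le> log_max_modulus f (log_max_modulus h (2 * t - ln 2) - C)"
  shows "log_regular (f \<circ> h)"
proof -
  have fh: "f \<circ> h holomorphic_on UNIV" "\<not> (f \<circ> h) constant_on UNIV"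
    using holomorphic_on_compose_gen[OF h(1) f(1)] compose_not_constant[OF f h] by auto
  obtain C where C: "\<forall>\<^sub>F t in at_top.
      exp (log_max_modulus f (log_max_modulus h (t - ln 2) - C)) \<le> max_modulus (exp t) (f \<circ> h)"
    using log_max_modulus_compose_ge[OF f h] by blast
  have "filterlim (\<lambda>t::real. 2 * t) at_top at_top"
    by real_asymp
  from filterlim_iff[THEN iffD1, OF this, rule_format, OF C] gap[of C]
  have "\<forall>\<^sub>F t in at_top. m * log_max_modulus (f \<circ> h) t \<le> log_max_modulus (f \<circ> h) (2 * t)"
  proof eventually_elim
    case (elim t)
    have "log_max_modulus (f \<circ> h) t \<le> log_max_modulus f (log_max_modulus h t)"
      using max_modulus_compose_le[OF f h, of t] by (simp flip: exp_log_max_modulus[OF fh])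
    then have "m * log_max_modulus (f \<circ> h) t \<le> m * log_max_modulus f (log_max_modulus h t)"
      using \<open>m > 2\<close> by simp
    also have "\<dots> \<le> log_max_modulus f (log_max_modulus h (2 * t - ln 2) - C)"
      using elim by simp
    also have "\<dots> \<le> log_max_modulus (f \<circ> h) (2 * t)"
      using elim by (simp flip: exp_log_max_modulus[OF fh])
    finally show ?case .
  qed
  then show ?thesis
    using \<open>m > 2\<close> by (intro log_regular_if_superlinear[OF fh, of 2 m]) auto
qed

text \<open>Dilation by exactly 2 would give the factor \<open>2 + c\<close>. Giving up half of the
  surplus leaves room for \<open>l < 2\<close>, so that \<open>l * t\<close> eventually lies below
  \<open>2 * t - ln 2\<close>.\<close>

lemma intermediate_dilation:
  fixes c :: real
  assumes c: "c > 0"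
  obtains l where "1 \<le> l" "l < 2" "l + c * (l - 1) = 2 + c / 2"
proof
  define e where "e = c / (2 * (1 + c))"
  have e: "0 < e" "e \<le> 1" "(1 + c) * e = c / 2"
    using c by (simp_all add: e_def divide_simps)
  then show "1 \<le> 2 - e" "2 - e < 2" "(2 - e) + c * ((2 - e) - 1) = 2 + c / 2"
    by (simp_all add: algebra_simps)
qed

lemma dilation_eventually_le:
  fixes l :: real
  assumes "l < 2"
  shows "\<forall>\<^sub>F t in at_top. l * t \<le> 2 * t - ln 2"
  using eventually_ge_at_top[of "ln 2 / (2 - l)"]
  by eventually_elim (use assms in \<open>simp add: field_simps\<close>)

lemma log_regular_compose_left:
  assumes "log_regular f" and h: "h holomorphic_on UNIV" "\<not> h constant_on UNIV"
  shows "log_regular (f \<circ> h)"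
proof -
  have f: "f holomorphic_on UNIV" "\<not> f constant_on UNIV"
    using assms(1) transcendental_entire_not_constant
    by (auto simp: log_regular_def log_regular_with_def transcendental_entire_def)
  obtain c where c: "c > 0" and ev:
    "\<forall>\<^sub>F t in at_top. \<forall>l\<ge>1. (l + c * (l - 1)) * log_max_modulus f t \<le> log_max_modulus f (l * t)"
    using log_regular_superlinear[OF assms(1)] by blast
  obtain l where l: "1 \<le> l" "l < 2" "l + c * (l - 1) = 2 + c / 2"
    using intermediate_dilation[OF c] by blast
  show ?thesis
  proof (rule log_regular_compose_if[OF f h])
    show "2 + c / 2 > 2" using c by simp
    fix C
    \<comment> \<open>The midpoint of \<open>l\<close> and 2 leaves room on both sides: below 2 for
      the loss of \<open>ln 2\<close>, above \<open>l\<close> for the loss of \<open>C\<close> in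
      the convexity bound for \<open>h\<close>.\<close>
    have "\<forall>\<^sub>F t in at_top. (l + 2) / 2 * t \<le> 2 * t - ln 2"
      using l by (intro dilation_eventually_le) simp
    moreover have "\<forall>\<^sub>F t in at_top. l * log_max_modulus h t + C \<le> log_max_modulus h ((l + 2) / 2 * t)"
      using l by (intro convex_dilation_lower_bound convex_log_max_modulus log_max_modulus_at_top h) auto
    moreover note filterlim_iff[THEN iffD1, OF log_max_modulus_at_top[OF h], rule_format, OF ev]
    ultimately show "\<forall>\<^sub>F t in at_top. (2 + c / 2) * log_max_modulus f (log_max_modulus h t)
        \<le> log_max_modulus f (log_max_modulus h (2 * t - ln 2) - C)"
    proof eventually_elim
      case (elim t)
      have "(2 + c / 2) * log_max_modulus f (log_max_modulus h t) \<le> log_max_modulus f (l * log_max_modulus h t)"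
        using elim(3) l by metis
      also have "\<dots> \<le> log_max_modulus f (log_max_modulus h (2 * t - ln 2) - C)"
        using elim(2) monoD[OF mono_log_max_modulus[OF h] elim(1)]
        by (intro monoD[OF mono_log_max_modulus[OF f]]) linarith
      finally show ?case .
    qed
  qed
qed

lemma log_regular_compose_right:
  assumes f: "f holomorphic_on UNIV" "\<not> f constant_on UNIV" and "log_regular h"
  shows "log_regular (f \<circ> h)"
proof -
  have h: "h holomorphic_on UNIV" "\<not> h constant_on UNIV"
    using assms(3) transcendental_entire_not_constant
    by (auto simp: log_regular_def log_regular_with_def transcendental_entire_def)
  obtain c where c: "c > 0" and ev:
    "\<forall>\<^sub>F t in at_top. \<forall>l\<ge>1. (l + c * (l - 1)) * log_max_modulus h t \<le> log_max_modulus h (l * t)"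
    using log_regular_superlinear[OF assms(3)] by blast
  obtain l where l: "1 \<le> l" "l < 2" "l + c * (l - 1) = 2 + c / 2"
    using intermediate_dilation[OF c] by blast
  show ?thesis
  proof (rule log_regular_compose_if[OF f h])
    \<comment> \<open>Of the surplus \<open>c / 2\<close> gained by \<open>h\<close>, absorbing
      \<open>C\<close> leaves \<open>c / 4\<close>, and the merely convex growth of \<open>f\<close>
      leaves \<open>c / 8\<close>.\<close>
    show "2 + c / 8 > 2" using c by simp
    fix C
    have "\<forall>\<^sub>F t in at_top. l * t \<le> 2 * t - ln 2"
      using l by (intro dilation_eventually_le)
    moreover note ev
    moreover have "\<forall>\<^sub>F t in at_top. C / (c / 4) \<le> log_max_modulus h t"
      using log_max_modulus_at_top[OF h] by (auto simp: filterlim_at_top)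
    moreover have "\<forall>\<^sub>F s in at_top. (2 + c / 8) * log_max_modulus f s + 0 \<le> log_max_modulus f ((2 + c / 4) * s)"
      using c by (intro convex_dilation_lower_bound convex_log_max_modulus log_max_modulus_at_top f) auto
    note filterlim_iff[THEN iffD1, OF log_max_modulus_at_top[OF h], rule_format, OF this]
    ultimately show "\<forall>\<^sub>F t in at_top. (2 + c / 8) * log_max_modulus f (log_max_modulus h t)
        \<le> log_max_modulus f (log_max_modulus h (2 * t - ln 2) - C)"
    proof eventually_elim
      case (elim t)
      have "C \<le> c / 4 * log_max_modulus h t"
        using elim(3) c by (simp add: field_simps)
      moreover have "(2 + c / 2) * log_max_modulus h t \<le> log_max_modulus h (l * t)"
        using elim(2) l by metis
      moreover note monoD[OF mono_log_max_modulus[OF h] elim(1)]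
      ultimately have "(2 + c / 4) * log_max_modulus h t \<le> log_max_modulus h (2 * t - ln 2) - C"
        by (simp add: algebra_simps)
      from monoD[OF mono_log_max_modulus[OF f] this] show ?case
        using elim(4) by simp
    qed
  qed
qed

section \<open>Finite compositions\<close>

lemma foldr_compose_entire:
  assumes "\<And>f. f \<in> set fs \<Longrightarrow> f holomorphic_on UNIV \<and> \<not> f constant_on UNIV"
  shows "foldr (\<circ>) fs id holomorphic_on (UNIV :: complex set) \<and> \<not> foldr (\<circ>) fs id constant_on (UNIV :: complex set)"
  using assms
proof (induction fs)
  case Nil
  have "\<not> (id :: complex \<Rightarrow> complex) constant_on UNIV"
    by (auto simp: constant_on_def) (metis zero_neq_one)
  then show ?case
    by (auto simp: id_def)
next
  case (Cons f fs)
  define h where "h = foldr (\<circ>) fs (id :: complex \<Rightarrow> complex)"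
  have f: "f holomorphic_on UNIV" "\<not> f constant_on UNIV"
    using Cons.prems by simp_all
  have h: "h holomorphic_on UNIV" "\<not> h constant_on UNIV"
    unfolding h_def using Cons.IH Cons.prems by (blast intro: list.set_intros)+
  have "foldr (\<circ>) (f # fs) id = f \<circ> h"
    unfolding h_def foldr_Cons o_apply ..
  moreover have "f \<circ> h holomorphic_on UNIV"
    using holomorphic_on_compose_gen[OF h(1) f(1)] by simp
  ultimately show ?case
    using compose_not_constant[OF f h] by metis
qed

text \<open>Splits off the outermost function: either it is log-regular itself, or some later one is
  and induction applies to the tail. The empty list contradicts the second assumption.\<close>

lemma log_regular_foldr_compose:
  assumes "\<And>f. f \<in> set fs \<Longrightarrow> f holomorphic_on UNIV \<and> \<not> f constant_on UNIV"
    and "\<exists>f\<in>set fs. log_regular f"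
  shows "log_regular (foldr (\<circ>) fs id)"
  using assms
proof (induction fs)
  case (Cons f fs)
  define h where "h = foldr (\<circ>) fs (id :: complex \<Rightarrow> complex)"
  have f: "f holomorphic_on UNIV" "\<not> f constant_on UNIV"
    using Cons.prems by simp_all
  have h: "h holomorphic_on UNIV \<and> \<not> h constant_on UNIV"
    unfolding h_def by (rule foldr_compose_entire) (use Cons.prems in simp)
  have "log_regular (f \<circ> h)"
  proof (cases "log_regular f")
    case True
    with h show ?thesis
      by (intro log_regular_compose_left) blast+
  next
    case False
    then have "log_regular h"
      unfolding h_def using Cons.prems by (intro Cons.IH) auto
    with f show ?thesis
      by (intro log_regular_compose_right)
  qed
  moreover have "foldr (\<circ>) (f # fs) id = f \<circ> h"
    unfolding h_def foldr_Cons o_apply ..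
  ultimately show ?case
    by metis
qed simp

theorem theorem2p3:
  fixes k :: nat and f :: "nat \<Rightarrow> complex \<Rightarrow> complex" and g :: "complex \<Rightarrow> complex"
  assumes "k \<ge> 1"
    and "\<And>i. i \<in> {1..k} \<Longrightarrow> f i holomorphic_on UNIV"
    and "\<And>i. i \<in> {1..k} \<Longrightarrow> \<not> f i constant_on UNIV"
    and "\<exists>j\<in>{1..k}. log_regular (f j)"
    and "g = foldr (\<circ>) (map f [1..<Suc k]) id"
  shows "log_regular g"
proof -
  have "set [1..<Suc k] = {1..k}"
    by auto
  then show ?thesis
    unfolding assms(5) using assms(2-4)
    by (intro log_regular_foldr_compose) (auto simp del: upt_Suc)
qed

end
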